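(* Let $\Lambda=\{\lambda_n\}_{n=1}^{\infty}$ be a strictly increasing sequence of positive real numbers such that $\sum_{n=1}^{\infty}\frac{1}{\lambda_n}<\infty$ and $\inf_{n}(\lambda_{n+1}-\lambda_n)>0$. Let $M_\Lambda=\{e_n\}_{n=1}^\infty$ with $e_n(t)=t^{\lambda_n}$, and let $\overline{M_\Lambda}$ be the closed span of $M_\Lambda$ in $L^2(0,1)$. Then there exists a unique family of functions $$r_\Lambda=\{r_n: n\in\mathbb{N}\}\subset\overline{M_\Lambda}$$ that is biorthogonal to $M_\Lambda$, and this family is such that for every $\epsilon>0$ there is a constant $m_\epsilon>0$, independent of $n\in\mathbb{N}$ but depending on $\Lambda$, so that $$\|r_n\|_{L^2(0,1)}\le m_\epsilon(1+\epsilon)^{\lambda_n}\qquad\text{for all } n\in\mathbb{N}.$$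
   Context: $L^2(0,1)$ is the complex Hilbert space with inner product $\langle f,g\rangle=\int_0^1 f(t)\overline{g(t)}\,dt$. A family $\{r_n\}_{n\in\mathbb{N}}$ is biorthogonal to $M_\Lambda=\{e_n\}_{n\in\mathbb{N}}$ if $\langle e_n,r_m\rangle=1$ when $m=n$ and $\langle e_n,r_m\rangle=0$ when $m\neq n$. *)

theory Defs
  imports "HOL-Analysis.Analysis"
begin

abbreviation leb01 :: "real measure" where
  "leb01 \<equiv> lebesgue_on {0<..<1}"

text \<open>
  Elements of the Hilbert space are represented by functions; two functions denote the same
  element iff they agree almost everywhere with respect to \<open>leb01\<close>. Values outside
  the open unit interval are irrelevant.
\<close>

definition L2_01 :: "(real \<Rightarrow> complex) set" where
  "L2_01 = {f \<in> borel_measurable leb01. integrable leb01 (\<lambda>t. (cmod (f t))\<^sup>2)}"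

definition L2_inner :: "(real \<Rightarrow> complex) \<Rightarrow> (real \<Rightarrow> complex) \<Rightarrow> complex" where
  "L2_inner f g = (LINT t|leb01. f t * cnj (g t))"

definition L2_norm01 :: "(real \<Rightarrow> complex) \<Rightarrow> real" where
  "L2_norm01 f = sqrt (LINT t|leb01. (cmod (f t))\<^sup>2)"

definition complex_span :: "(real \<Rightarrow> complex) set \<Rightarrow> (real \<Rightarrow> complex) set" where
  "complex_span S = {\<lambda>t. \<Sum>g\<in>F. c g * g t | F c. finite F \<and> F \<subseteq> S}"

definition L2_closed_span :: "(real \<Rightarrow> complex) set \<Rightarrow> (real \<Rightarrow> complex) set" where
  "L2_closed_span S =
     {f \<in> L2_01. \<forall>\<delta>>0. \<exists>p \<in> complex_span S. L2_norm01 (\<lambda>t. f t - p t) < \<delta>}"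

definition biorthogonal :: "(nat \<Rightarrow> real \<Rightarrow> complex) \<Rightarrow> (nat \<Rightarrow> real \<Rightarrow> complex) \<Rightarrow> bool" where
  "biorthogonal r e \<longleftrightarrow> (\<forall>n m. L2_inner (e n) (r m) = (if m = n then 1 else 0))"

text \<open>
  Sequences are indexed from 0, so \<open>\<Lambda> n\<close> is the exponent usually written with index \<open>n + 1\<close>.
\<close>

definition power_fun :: "(nat \<Rightarrow> real) \<Rightarrow> nat \<Rightarrow> real \<Rightarrow> complex" where
  "power_fun \<Lambda> n t = complex_of_real (t powr \<Lambda> n)"

end

theory Submission
  imports Defs "HOL-Computational_Algebra.Polynomial"
begin

text \<open>
  The rational function \<open>R s = c \<cdot> (\<Prod>m\<in>{..N}-{n}. s - \<Lambda> m) / (\<Prod>k\<le>N. s + \<Lambda> k + 1)\<close> with \<open>R (\<Lambda> n) = 1\<close>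
  has a partial fraction expansion \<open>\<Sum>k\<le>N. a k / (s + \<Lambda> k + 1)\<close>. As
  \<open>t powr \<Lambda> m\<close> and \<open>t powr \<Lambda> k\<close> have inner product \<open>1 / (\<Lambda> m + \<Lambda> k + 1)\<close>, the function
  \<open>\<Sum>k\<le>N. a k * t powr \<Lambda> k\<close> is dual to \<open>t powr \<Lambda> n\<close> within the first \<open>N + 1\<close> powers, and its
  squared norm is its own coefficient \<open>a n = (2 * \<Lambda> n + 1) * P\<^sup>2\<close>, where
  \<open>P = (\<Prod>m\<in>{..N}-{n}. (\<Lambda> n + \<Lambda> m + 1) / \<bar>\<Lambda> n - \<Lambda> m\<bar>)\<close>.

  Write \<open>x = \<Lambda> n\<close>. The factors of \<open>P\<close> with \<open>\<Lambda> m \<ge> 2 * x\<close> contribute \<open>exp (o(x))\<close>, because the series of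
  reciprocals converges. By the gap condition with gap \<open>d\<close>, the other factors contribute at most
  \<open>A ^ n / fact n * A ^ (K - n) / fact (K - n)\<close> with \<open>A = (3 * x + 1) / d\<close> and \<open>K = o(x)\<close>. This is again
  \<open>exp (o(x))\<close>, since \<open>A ^ i / fact i \<le> exp (A * \<delta>) / \<delta> ^ i\<close> for every \<open>\<delta> > 0\<close>.

  The squared distance of two such functions for \<open>N \<le> M\<close> is the difference of their squared norms, which are
  bounded in \<open>N\<close>. So these functions converge as \<open>N\<close> grows, and the limit is the required \<open>r n\<close>.
\<close>

section \<open>The Hilbert space\<close>

lemma L2_01_D:
  assumes "f \<in> L2_01"
  shows "f \<in> borel_measurable leb01" "integrable leb01 (\<lambda>t. (cmod (f t))\<^sup>2)"
  using assms by (auto simp: L2_01_def)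

lemma L2_norm01_nonneg: "0 \<le> L2_norm01 f"
  by (simp add: L2_norm01_def)

lemma L2_norm01_sq: "(L2_norm01 f)\<^sup>2 = (LINT t|leb01. (cmod (f t))\<^sup>2)"
  by (simp add: L2_norm01_def)

lemma nn_integral_L2:
  assumes "f \<in> L2_01"
  shows "(\<integral>\<^sup>+ t. ennreal ((cmod (f t))\<^sup>2) \<partial>leb01) = ennreal ((L2_norm01 f)\<^sup>2)"
  unfolding L2_norm01_sq using L2_01_D[OF assms] by (intro nn_integral_eq_integral) auto

text \<open>\<open>L2_norm01\<close> is 0 when the squared modulus is not integrable, so a bound on
  it cannot prove membership. A finite nonnegative integral can, and Fatou's lemma delivers limits
  in that form.\<close>

lemma L2_01_nn_integralI:
  assumes "f \<in> borel_measurable leb01"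
    and "(\<integral>\<^sup>+ t. ennreal ((cmod (f t))\<^sup>2) \<partial>leb01) \<le> ennreal (B\<^sup>2)" "0 \<le> B"
  shows "f \<in> L2_01" "L2_norm01 f \<le> B"
proof -
  have [measurable]: "f \<in> borel_measurable leb01" by fact
  have "(\<integral>\<^sup>+ t. ennreal ((cmod (f t))\<^sup>2) \<partial>leb01) < \<infinity>"
    using assms(2) by (simp add: le_less_trans[OF _ ennreal_less_top])
  then have "integrable leb01 (\<lambda>t. (cmod (f t))\<^sup>2)"
    by (intro integrableI_nonneg) auto
  then show f: "f \<in> L2_01" using assms(1) by (simp add: L2_01_def)
  show "L2_norm01 f \<le> B"
    using assms(2,3) unfolding nn_integral_L2[OF f] by (auto dest: power2_le_imp_le)
qed

text \<open>Cauchy-Schwarz for nonnegative integrals presupposes only measurability, so one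
  inequality yields both the integrability of the product and the bound.\<close>

lemma L2_mult:
  assumes f: "f \<in> L2_01" and g: "g \<in> L2_01"
  shows "integrable leb01 (\<lambda>t. cmod (f t) * cmod (g t))"
    and "(LINT t|leb01. cmod (f t) * cmod (g t)) \<le> L2_norm01 f * L2_norm01 g"
proof -
  have [measurable]: "f \<in> borel_measurable leb01" "g \<in> borel_measurable leb01"
    using f g by (auto dest: L2_01_D)
  have "(\<integral>\<^sup>+ t. ennreal (cmod (f t) * cmod (g t)) \<partial>leb01)\<^sup>2
      \<le> ennreal ((L2_norm01 f * L2_norm01 g)\<^sup>2)"
    using Cauchy_Schwarz_nn_integral[of "\<lambda>t. ennreal (cmod (f t))" leb01 "\<lambda>t. ennreal (cmod (g t))"]
    by (simp add: ennreal_power nn_integral_L2[OF f] nn_integral_L2[OF g] power_mult_distrib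
        flip: ennreal_mult)
  then have *: "(\<integral>\<^sup>+ t. ennreal (cmod (f t) * cmod (g t)) \<partial>leb01)
      \<le> ennreal (L2_norm01 f * L2_norm01 g)"
    by (cases "\<integral>\<^sup>+ t. ennreal (cmod (f t) * cmod (g t)) \<partial>leb01" rule: ennreal_cases)
       (auto simp: ennreal_power top_unique L2_norm01_nonneg intro!: ennreal_leI
         intro: power2_le_imp_le)
  show int: "integrable leb01 (\<lambda>t. cmod (f t) * cmod (g t))"
    using * by (intro integrableI_nonneg) (auto intro: le_less_trans[OF _ ennreal_less_top])
  show "(LINT t|leb01. cmod (f t) * cmod (g t)) \<le> L2_norm01 f * L2_norm01 g"
    using * nn_integral_eq_integral[OF int]
    by (simp add: L2_norm01_nonneg)
qed

lemma L2_inner_integrable: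
  assumes f: "f \<in> L2_01" and g: "g \<in> L2_01"
  shows "integrable leb01 (\<lambda>t. f t * cnj (g t))"
proof (rule Bochner_Integration.integrable_bound[OF L2_mult(1)[OF f g]])
  have [measurable]: "f \<in> borel_measurable leb01" "g \<in> borel_measurable leb01"
    using f g by (auto dest: L2_01_D)
  have [measurable]: "cnj \<in> borel_measurable borel"
    by (intro borel_measurable_continuous_onI continuous_intros)
  show "(\<lambda>t. f t * cnj (g t)) \<in> borel_measurable leb01"
    by measurable
qed (auto simp: norm_mult)

lemma L2_Cauchy_Schwarz:
  assumes f: "f \<in> L2_01" and g: "g \<in> L2_01"
  shows "cmod (L2_inner f g) \<le> L2_norm01 f * L2_norm01 g"
proof -
  have "cmod (L2_inner f g) \<le> (LINT t|leb01. cmod (f t * cnj (g t)))"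
    unfolding L2_inner_def by (rule Bochner_Integration.integral_norm_bound)
  with L2_mult(2)[OF f g] show ?thesis by (simp add: norm_mult)
qed

lemma L2_01_add:
  assumes f: "f \<in> L2_01" and g: "g \<in> L2_01"
  shows "(\<lambda>t. f t + g t) \<in> L2_01"
    and "L2_norm01 (\<lambda>t. f t + g t) \<le> L2_norm01 f + L2_norm01 g"
proof -
  note i = L2_01_D(2)[OF f] L2_01_D(2)[OF g] L2_mult(1)[OF f g]
  have [measurable]: "f \<in> borel_measurable leb01" "g \<in> borel_measurable leb01"
    using f g by (auto dest: L2_01_D)
  have int: "integrable leb01 (\<lambda>t. (cmod (f t))\<^sup>2 + (cmod (g t))\<^sup>2 + 2 * (cmod (f t) * cmod (g t)))"
    using i by simp
  have pt: "(cmod (f t + g t))\<^sup>2 \<le> (cmod (f t))\<^sup>2 + (cmod (g t))\<^sup>2 + 2 * (cmod (f t) * cmod (g t))" for t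
    using power_mono[OF norm_triangle_ineq[of "f t" "g t"], of 2] by (simp add: power2_sum)
  have int': "integrable leb01 (\<lambda>t. (cmod (f t + g t))\<^sup>2)"
    using pt by (intro Bochner_Integration.integrable_bound[OF int]) auto
  then show "(\<lambda>t. f t + g t) \<in> L2_01"
    by (simp add: L2_01_def)
  have "(L2_norm01 (\<lambda>t. f t + g t))\<^sup>2
      \<le> (LINT t|leb01. (cmod (f t))\<^sup>2 + (cmod (g t))\<^sup>2 + 2 * (cmod (f t) * cmod (g t)))"
    unfolding L2_norm01_sq using int int' pt by (intro integral_mono) auto
  also have "\<dots> = (L2_norm01 f)\<^sup>2 + (L2_norm01 g)\<^sup>2 + 2 * (LINT t|leb01. cmod (f t) * cmod (g t))"
    using i by (simp add: L2_norm01_sq)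
  also have "\<dots> \<le> (L2_norm01 f + L2_norm01 g)\<^sup>2"
    using L2_mult(2)[OF f g] by (simp add: power2_sum)
  finally show "L2_norm01 (\<lambda>t. f t + g t) \<le> L2_norm01 f + L2_norm01 g"
    by (rule power2_le_imp_le) (simp add: L2_norm01_nonneg)
qed

lemma L2_01_cmult:
  assumes "f \<in> L2_01"
  shows "(\<lambda>t. c * f t) \<in> L2_01"
  using L2_01_D[OF assms] by (simp add: L2_01_def norm_mult power_mult_distrib)

lemma L2_01_diff:
  assumes f: "f \<in> L2_01" and g: "g \<in> L2_01"
  shows "(\<lambda>t. f t - g t) \<in> L2_01"
  using L2_01_add(1)[OF f L2_01_cmult[OF g, of "-1"]] by simp

lemma L2_01_sum:
  assumes "\<And>k. k \<in> K \<Longrightarrow> f k \<in> L2_01"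
  shows "(\<lambda>t. \<Sum>k\<in>K. f k t) \<in> L2_01"
  using assms
proof (induction K rule: infinite_finite_induct)
  case (insert k K)
  then show ?case using L2_01_add(1)[of "f k"] by simp
qed (auto simp: L2_01_def)

lemma L2_inner_diff_left:
  assumes "f \<in> L2_01" "g \<in> L2_01" "h \<in> L2_01"
  shows "L2_inner (\<lambda>t. f t - g t) h = L2_inner f h - L2_inner g h"
  using L2_inner_integrable[OF assms(1,3)] L2_inner_integrable[OF assms(2,3)]
  by (simp add: L2_inner_def left_diff_distrib)

lemma L2_inner_diff_right:
  assumes "f \<in> L2_01" "g \<in> L2_01" "h \<in> L2_01"
  shows "L2_inner h (\<lambda>t. f t - g t) = L2_inner h f - L2_inner h g"
  using L2_inner_integrable[OF assms(3,1)] L2_inner_integrable[OF assms(3,2)]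
  by (simp add: L2_inner_def right_diff_distrib)

lemma L2_inner_sum_left:
  assumes "\<And>k. k \<in> K \<Longrightarrow> f k \<in> L2_01" "h \<in> L2_01"
  shows "L2_inner (\<lambda>t. \<Sum>k\<in>K. c k * f k t) h = (\<Sum>k\<in>K. c k * L2_inner (f k) h)"
proof -
  have "integrable leb01 (\<lambda>t. c k * (f k t * cnj (h t)))" if "k \<in> K" for k
    using L2_inner_integrable[OF assms(1)[OF that] assms(2)] by simp
  then have "(LINT t|leb01. (\<Sum>k\<in>K. c k * (f k t * cnj (h t))))
      = (\<Sum>k\<in>K. LINT t|leb01. c k * (f k t * cnj (h t)))"
    by (rule Bochner_Integration.integral_sum)
  then show ?thesis
    by (simp add: L2_inner_def sum_distrib_right mult.assoc)
qed

lemma L2_inner_commute: "L2_inner g f = cnj (L2_inner f g)"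
  unfolding L2_inner_def by (subst Bochner_Integration.integral_cnj[symmetric]) (simp add: mult.commute)

lemma L2_inner_self: "L2_inner f f = complex_of_real ((L2_norm01 f)\<^sup>2)"
  by (simp add: L2_inner_def L2_norm01_sq flip: complex_norm_square integral_complex_of_real)

lemma L2_norm01_eq_0_imp_AE:
  assumes "f \<in> L2_01" "L2_norm01 f = 0"
  shows "AE t in leb01. f t = 0"
proof -
  have "(LINT t|leb01. (cmod (f t))\<^sup>2) = 0"
    using assms(2) by (simp flip: L2_norm01_sq)
  then show ?thesis
    using L2_01_D[OF assms(1)] by (subst (asm) integral_nonneg_eq_0_iff_AE) auto
qed

lemma L2_norm01_minus_commute: "L2_norm01 (\<lambda>t. f t - g t) = L2_norm01 (\<lambda>t. g t - f t)"
  by (simp add: L2_norm01_def norm_minus_commute)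

section \<open>Total mass and completeness\<close>

lemma emeasure_leb01: "emeasure leb01 (space leb01) = 1"
  by (simp add: space_restrict_space emeasure_restrict_space)

text \<open>Pairing with the constant 1 bounds the \<open>L\<^sup>1\<close>-norm by the
  \<open>L\<^sup>2\<close>-norm. The completeness proof uses this to get summable
  increments.\<close>

lemma L2_01_const: "(\<lambda>t. 1) \<in> L2_01" "L2_norm01 (\<lambda>t. 1) = 1"
proof -
  have "finite_measure leb01"
    using emeasure_leb01 by (intro finite_measureI) simp
  then show "(\<lambda>t. 1) \<in> L2_01"
    unfolding L2_01_def using finite_measure.integrable_const[of leb01 "1::real"] by simp
  show "L2_norm01 (\<lambda>t. 1) = 1"
    using emeasure_leb01 by (simp add: L2_norm01_def measure_def del: emeasure_restrict_space)
qed

lemma L2_complete: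
  assumes f: "\<And>k. f k \<in> L2_01"
    and C: "\<And>e. e > 0 \<Longrightarrow> \<exists>N. \<forall>m\<ge>N. \<forall>n\<ge>N. L2_norm01 (\<lambda>t. f m t - f n t) \<le> e"
  shows "\<exists>g\<in>L2_01. (\<lambda>n. L2_norm01 (\<lambda>t. g t - f n t)) \<longlonglongrightarrow> 0"
proof -
  have [measurable]: "f k \<in> borel_measurable leb01" for k
    using f[of k] by (rule L2_01_D)
  obtain N where N: "\<And>k m n. m \<ge> N k \<Longrightarrow> n \<ge> N k \<Longrightarrow> L2_norm01 (\<lambda>t. f m t - f n t) \<le> (1/2)^k"
    using C[of "(1/2)^k" for k] by (metis zero_less_divide_1_iff zero_less_numeral zero_less_power)
  \<comment> \<open>Along \<open>\<sigma>\<close> the increments have \<open>L\<^sup>1\<close>-norm at most \<open>(1/2) ^ k\<close>, so the subsequence converges almost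
     everywhere; Fatou's lemma then gives convergence in norm of the whole sequence.\<close>
  define \<sigma> where "\<sigma> k = k + (\<Sum>i\<le>k. N i)" for k
  \<comment> \<open>Summing over all \<open>i \<le> j\<close> puts \<open>\<sigma> j\<close> above
    every threshold \<open>N k\<close> with \<open>k \<le> j\<close>.\<close>
  have \<sigma>N: "\<sigma> j \<ge> N k" if "j \<ge> k" for j k
    using that member_le_sum[of k "{..j}" N] by (simp add: \<sigma>_def)
  define d where "d k t = f (\<sigma> (Suc k)) t - f (\<sigma> k) t" for k t
  have d: "d k \<in> L2_01" for k
    unfolding d_def by (intro L2_01_diff f)
  have [measurable]: "d k \<in> borel_measurable leb01" for k
    using d[of k] by (rule L2_01_D)
  have d_le: "(\<integral>\<^sup>+ t. ennreal (cmod (d k t)) \<partial>leb01) \<le> ennreal ((1/2)^k)" for k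
  proof -
    have "integrable leb01 (\<lambda>t. cmod (d k t))" "(LINT t|leb01. cmod (d k t)) \<le> L2_norm01 (d k)"
      using L2_mult[OF d L2_01_const(1), of k] by (simp_all add: L2_01_const)
    moreover have "L2_norm01 (d k) \<le> (1/2)^k"
      unfolding d_def by (intro N \<sigma>N) auto
    ultimately show ?thesis
      by (subst nn_integral_eq_integral) (auto intro!: ennreal_leI)
  qed
  have "(\<integral>\<^sup>+ t. (\<Sum>k. ennreal (cmod (d k t))) \<partial>leb01) = (\<Sum>k. \<integral>\<^sup>+ t. ennreal (cmod (d k t)) \<partial>leb01)"
    by (intro nn_integral_suminf) auto
  also have "\<dots> \<le> (\<Sum>k. ennreal ((1/2)^k))"
    by (intro suminf_le d_le) auto
  also have "\<dots> = ennreal 2"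
    by (intro suminf_ennreal_eq) (use geometric_sums[of "1/2::real"] in auto)
  finally have "(\<integral>\<^sup>+ t. (\<Sum>k. ennreal (cmod (d k t))) \<partial>leb01) \<noteq> \<infinity>"
    by (auto simp: top_unique)
  then have "AE t in leb01. (\<Sum>k. ennreal (cmod (d k t))) \<noteq> \<infinity>"
    by (intro nn_integral_PInf_AE) auto
  then have AE_conv: "AE t in leb01. convergent (\<lambda>k. f (\<sigma> k) t)"
  proof eventually_elim
    case (elim t)
    then have "summable (\<lambda>k. cmod (d k t))"
      by (intro summable_suminf_not_top) auto
    then have "summable (\<lambda>k. d k t)"
      by (rule summable_norm_cancel)
    then have "convergent (\<lambda>n. \<Sum>k<n. d k t)"
      by (simp add: summable_iff_convergent)
    moreover have "(\<Sum>k<n. d k t) = f (\<sigma> n) t - f (\<sigma> 0) t" for n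
      unfolding d_def by (rule sum_lessThan_telescope)
    ultimately have "convergent (\<lambda>n. (f (\<sigma> n) t - f (\<sigma> 0) t) + f (\<sigma> 0) t)"
      by (intro convergent_add convergent_const) simp
    then show ?case by simp
  qed
  \<comment> \<open>Where the subsequence diverges, \<open>lim\<close> is an arbitrary value; this
    happens only on a null set.\<close>
  define g where "g t = lim (\<lambda>k. f (\<sigma> k) t)" for t
  have [measurable]: "g \<in> borel_measurable leb01"
    unfolding g_def by measurable
  have g_lim: "AE t in leb01. (\<lambda>k. f (\<sigma> k) t) \<longlonglongrightarrow> g t"
    using AE_conv by eventually_elim (simp add: g_def convergent_LIMSEQ_iff)
  have gf: "(\<lambda>t. g t - f n t) \<in> L2_01 \<and> L2_norm01 (\<lambda>t. g t - f n t) \<le> (1/2)^k" if n: "n \<ge> N k" for n k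
  proof -
    have "(\<integral>\<^sup>+ t. ennreal ((cmod (g t - f n t))\<^sup>2) \<partial>leb01)
        = (\<integral>\<^sup>+ t. liminf (\<lambda>j. ennreal ((cmod (f (\<sigma> j) t - f n t))\<^sup>2)) \<partial>leb01)"
    proof (rule nn_integral_cong_AE)
      show "AE t in leb01. ennreal ((cmod (g t - f n t))\<^sup>2)
          = liminf (\<lambda>j. ennreal ((cmod (f (\<sigma> j) t - f n t))\<^sup>2))"
        using g_lim
      proof eventually_elim
        case (elim t)
        then have "(\<lambda>j. ennreal ((cmod (f (\<sigma> j) t - f n t))\<^sup>2)) \<longlonglongrightarrow> ennreal ((cmod (g t - f n t))\<^sup>2)"
          by (intro tendsto_ennrealI tendsto_intros)
        then show ?case
          using lim_imp_Liminf[OF sequentially_bot] by metis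
      qed
    qed
    also have "\<dots> \<le> liminf (\<lambda>j. \<integral>\<^sup>+ t. ennreal ((cmod (f (\<sigma> j) t - f n t))\<^sup>2) \<partial>leb01)"
      by (intro nn_integral_liminf) auto
    also have "\<dots> \<le> liminf (\<lambda>j. ennreal (((1/2)^k)\<^sup>2))"
    proof (rule Liminf_mono)
      have "\<forall>j\<ge>k. (\<integral>\<^sup>+ t. ennreal ((cmod (f (\<sigma> j) t - f n t))\<^sup>2) \<partial>leb01) \<le> ennreal (((1/2)^k)\<^sup>2)"
        using N[OF \<sigma>N n]
        by (auto simp: nn_integral_L2[OF L2_01_diff[OF f f]] L2_norm01_nonneg intro!: ennreal_leI power_mono)
      then show "\<forall>\<^sub>F j in sequentially. (\<integral>\<^sup>+ t. ennreal ((cmod (f (\<sigma> j) t - f n t))\<^sup>2) \<partial>leb01)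
          \<le> ennreal (((1/2)^k)\<^sup>2)"
        by (auto simp: eventually_sequentially)
    qed
    also have "\<dots> = ennreal (((1/2)^k)\<^sup>2)"
      by (simp add: Liminf_const)
    finally show ?thesis
      using L2_01_nn_integralI[of "\<lambda>t. g t - f n t" "(1/2)^k"] by auto
  qed
  \<comment> \<open>So far only the differences \<open>g - f n\<close> are known to be square
    integrable; adding \<open>f (N 0)\<close> back gives \<open>g\<close> itself.\<close>
  have "g \<in> L2_01"
    using L2_01_add(1)[OF conjunct1[OF gf[of 0 "N 0"]] f[of "N 0"]] by simp
  moreover have "(\<lambda>n. L2_norm01 (\<lambda>t. g t - f n t)) \<longlonglongrightarrow> 0"
  proof (rule LIMSEQ_I)
    fix e :: real assume "e > 0"
    then obtain k where k: "(1/2)^k < e"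
      using real_arch_pow_inv[of e "1/2"] by auto
    have "norm (L2_norm01 (\<lambda>t. g t - f n t) - 0) < e" if "n \<ge> N k" for n
      using gf[OF that] k L2_norm01_nonneg[of "\<lambda>t. g t - f n t"] by auto
    then show "\<exists>M. \<forall>n\<ge>M. norm (L2_norm01 (\<lambda>t. g t - f n t) - 0) < e" by blast
  qed
  ultimately show ?thesis by blast
qed

section \<open>Partial fractions and product estimates\<close>

text \<open>Lagrange interpolation: a polynomial of degree below \<open>card I\<close> equals its
  interpolant \<open>q\<close> at the nodes \<open>x k\<close>. Dividing by the product of all
  \<open>s - x j\<close> turns each basis polynomial into a simple fraction.\<close>

lemma partial_fractions:
  fixes x :: "'i \<Rightarrow> 'a :: field"
  assumes fin: "finite I" and inj: "inj_on x I" and deg: "degree p < card I"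
    and s: "s \<notin> x ` I"
  shows "(\<Sum>k\<in>I. poly p (x k) / (\<Prod>j\<in>I-{k}. x k - x j) / (s - x k)) = poly p s / (\<Prod>j\<in>I. s - x j)"
proof -
  define w where "w k = poly p (x k) / (\<Prod>j\<in>I-{k}. x k - x j)" for k
  define q where "q = (\<Sum>k\<in>I. smult (w k) (\<Prod>j\<in>I-{k}. [:- x j, 1:]))"
  have "p = q"
  proof (rule poly_eqI_degree)
    show "poly p z = poly q z" if z: "z \<in> x ` I" for z
    proof -
      obtain i where i: "i \<in> I" "z = x i" using z by auto
      have nz: "(\<Prod>j\<in>I-{i}. x i - x j) \<noteq> 0"
        using fin inj i by (auto simp: inj_on_def)
      have "poly q z = (\<Sum>k\<in>I. w k * (\<Prod>j\<in>I-{k}. x i - x j))"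
        by (simp add: q_def i poly_sum poly_prod)
      \<comment> \<open>For \<open>k \<noteq> i\<close> the index \<open>i\<close> remains in the
        product and contributes the factor 0.\<close>
      also have "\<dots> = (\<Sum>k\<in>I. if k = i then w i * (\<Prod>j\<in>I-{i}. x i - x j) else 0)"
      proof (rule sum.cong)
        fix k assume "k \<in> I"
        show "w k * (\<Prod>j\<in>I-{k}. x i - x j) = (if k = i then w i * (\<Prod>j\<in>I-{i}. x i - x j) else 0)"
          using fin i by auto
      qed simp
      also have "\<dots> = w i * (\<Prod>j\<in>I-{i}. x i - x j)"
        using fin i by simp
      also have "\<dots> = poly p z"
        using nz by (simp add: w_def i)
      finally show ?thesis by simp
    qed
    show "card (x ` I) > degree p"
      using deg inj by (simp add: card_image)
    \<comment> \<open>The hypothesis on \<open>degree p\<close> makes \<open>card I\<close>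
      positive, so with truncated subtraction this still means a degree strictly below
      \<open>card I\<close>.\<close>
    have "degree q \<le> card I - 1"
      unfolding q_def
    proof (rule degree_sum_le[OF fin])
      fix k assume k: "k \<in> I"
      have "degree (\<Prod>j\<in>I-{k}. [:- x j, 1:]) \<le> (\<Sum>j\<in>I-{k}. degree [:- x j, 1:])"
        using fin degree_prod_sum_le[of "I - {k}" "\<lambda>j. [:- x j, 1:]"] by (simp add: comp_def)
      also have "\<dots> = card I - 1"
        using fin k by simp
      finally show "degree (smult (w k) (\<Prod>j\<in>I-{k}. [:- x j, 1:])) \<le> card I - 1"
        using degree_smult_le order_trans by blast
    qed
    then show "card (x ` I) > degree q"
      using deg inj by (simp add: card_image)
  qed
  then have "poly p s = (\<Sum>k\<in>I. w k * (\<Prod>j\<in>I-{k}. s - x j))"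
    by (simp add: q_def poly_sum poly_prod)
  then have "poly p s / (\<Prod>j\<in>I. s - x j) = (\<Sum>k\<in>I. w k * (\<Prod>j\<in>I-{k}. s - x j) / (\<Prod>j\<in>I. s - x j))"
    by (simp add: sum_divide_distrib)
  also have "\<dots> = (\<Sum>k\<in>I. w k / (s - x k))"
  proof (rule sum.cong)
    fix k assume k: "k \<in> I"
    have "(\<Prod>j\<in>I-{k}. s - x j) \<noteq> 0"
      using fin s by auto
    then show "w k * (\<Prod>j\<in>I-{k}. s - x j) / (\<Prod>j\<in>I. s - x j) = w k / (s - x k)"
      using fin k by (simp add: prod.remove)
  qed simp
  finally show ?thesis by (simp add: w_def)
qed

section \<open>Estimates for the product of ratios\<close>

lemma power_div_fact_le_exp:
  fixes z :: real
  assumes "z \<ge> 0"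
  shows "z ^ k / fact k \<le> exp z"
proof -
  have "(\<Sum>i\<in>{k}. z ^ i /\<^sub>R fact i) \<le> (\<Sum>i. z ^ i /\<^sub>R fact i)"
    using assms summable_exp_generic[of z] by (intro sum_le_suminf) auto
  then show ?thesis by (simp add: exp_def field_simps)
qed

text \<open>Below \<open>n\<close> the distances run through 1 to \<open>n\<close>, above it through
  1 to \<open>K - n\<close>.\<close>

lemma prod_div_nat_distance:
  fixes A :: real
  assumes "n \<le> K"
  shows "(\<Prod>m\<in>{..K}-{n}. A / \<bar>real m - real n\<bar>) = (A ^ n / fact n) * (A ^ (K - n) / fact (K - n))"
proof -
  have "(\<Prod>m\<in>{..K}-{n}. A / \<bar>real m - real n\<bar>) = (\<Prod>m\<in>{..<n} \<union> {n<..K}. A / \<bar>real m - real n\<bar>)"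
    using assms by (intro prod.cong) auto
  also have "\<dots> = (\<Prod>m<n. A / \<bar>real m - real n\<bar>) * (\<Prod>m\<in>{n<..K}. A / \<bar>real m - real n\<bar>)"
    by (intro prod.union_disjoint) auto
  also have "(\<Prod>m<n. A / \<bar>real m - real n\<bar>) = (\<Prod>i\<in>{1..n}. A / real i)"
    by (rule prod.reindex_bij_witness[of _ "\<lambda>i. n - i" "\<lambda>m. n - m"]) (auto simp: of_nat_diff)
  also have "\<dots> = A ^ n / fact n"
    by (simp add: prod_dividef fact_prod)
  also have "(\<Prod>m\<in>{n<..K}. A / \<bar>real m - real n\<bar>) = (\<Prod>i\<in>{1..K-n}. A / real i)"
    by (rule prod.reindex_bij_witness[of _ "\<lambda>i. n + i" "\<lambda>m. m - n"]) (auto simp: of_nat_diff)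
  also have "\<dots> = A ^ (K - n) / fact (K - n)"
    by (simp add: prod_dividef fact_prod)
  finally show ?thesis .
qed

lemma gap_distance:
  fixes \<Lambda> :: "nat \<Rightarrow> real"
  assumes gap: "\<And>n. d \<le> \<Lambda> (Suc n) - \<Lambda> n" and "d \<ge> 0"
  shows "d * \<bar>real m - real n\<bar> \<le> \<bar>\<Lambda> m - \<Lambda> n\<bar>"
proof -
  have *: "d * (real b - real a) \<le> \<Lambda> b - \<Lambda> a" if "a \<le> b" for a b
    using that
  proof (induction b rule: dec_induct)
    case (step b)
    then show ?case using gap[of b] by (simp add: algebra_simps)
  qed simp
  show ?thesis
  proof (cases "n \<le> m")
    case True
    then show ?thesis using *[OF True] by simp
  next
    case False
    then show ?thesis using *[of m n] by simp
  qed
qed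

text \<open>Numerators are at most \<open>3 * \<Lambda> n + 1\<close> and denominators at least
  \<open>d * \<bar>real m - real n\<bar>\<close>. The free parameter \<open>\<delta>\<close> trades
  a small growth rate in \<open>\<Lambda> n\<close> against the factor
  \<open>1 / \<delta> ^ K\<close>, which is affordable once \<open>K\<close> is small compared with
  \<open>\<Lambda> n\<close>.\<close>

lemma prod_ratio_near_bound:
  fixes x \<delta> d :: real
  assumes gap: "\<And>n. d \<le> \<Lambda> (Suc n) - \<Lambda> n" and d: "d > 0" and \<delta>: "0 < \<delta>"
    and pos: "\<And>n. \<Lambda> n > 0" and "n \<le> K" and near: "\<And>m. m \<le> K \<Longrightarrow> \<Lambda> m < 2 * \<Lambda> n"
  shows "(\<Prod>m\<in>{..K}-{n}. (\<Lambda> n + \<Lambda> m + 1) / \<bar>\<Lambda> n - \<Lambda> m\<bar>)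
    \<le> exp (2 * ((3 * \<Lambda> n + 1) / d * \<delta>)) / \<delta> ^ K"
proof -
  define A where "A = (3 * \<Lambda> n + 1) / d"
  have A: "A > 0" using pos[of n] d by (simp add: A_def)
  have "(\<Prod>m\<in>{..K}-{n}. (\<Lambda> n + \<Lambda> m + 1) / \<bar>\<Lambda> n - \<Lambda> m\<bar>) \<le> (\<Prod>m\<in>{..K}-{n}. A / \<bar>real m - real n\<bar>)"
  proof (rule prod_mono)
    fix m assume m: "m \<in> {..K} - {n}"
    have D: "0 < d * \<bar>real m - real n\<bar>" "d * \<bar>real m - real n\<bar> \<le> \<bar>\<Lambda> n - \<Lambda> m\<bar>"
      using gap_distance[of d \<Lambda> m n, OF gap] d m by (auto simp: abs_minus_commute)
    have "(\<Lambda> n + \<Lambda> m + 1) / \<bar>\<Lambda> n - \<Lambda> m\<bar> \<le> (3 * \<Lambda> n + 1) / (d * \<bar>real m - real n\<bar>)"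
      using D near[of m] m pos[of n] by (intro frac_le) auto
    then show "0 \<le> (\<Lambda> n + \<Lambda> m + 1) / \<bar>\<Lambda> n - \<Lambda> m\<bar> \<and> (\<Lambda> n + \<Lambda> m + 1) / \<bar>\<Lambda> n - \<Lambda> m\<bar> \<le> A / \<bar>real m - real n\<bar>"
      using pos[of n] pos[of m] by (simp add: A_def)
  qed
  also have "\<dots> = (A ^ n / fact n) * (A ^ (K - n) / fact (K - n))"
    by (rule prod_div_nat_distance) fact
  also have "\<dots> = ((A * \<delta>) ^ n / fact n) * ((A * \<delta>) ^ (K - n) / fact (K - n)) / \<delta> ^ K"
  proof -
    have "\<delta> ^ K = \<delta> ^ n * \<delta> ^ (K - n)"
      using \<open>n \<le> K\<close> by (simp flip: power_add)
    then show ?thesis using \<delta> by (simp add: power_mult_distrib field_simps)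
  qed
  also have "\<dots> \<le> exp (A * \<delta>) * exp (A * \<delta>) / \<delta> ^ K"
    using A \<delta> by (intro divide_right_mono mult_mono power_div_fact_le_exp) auto
  also have "\<dots> = exp (2 * (A * \<delta>)) / \<delta> ^ K"
    by (simp flip: exp_add)
  finally show ?thesis by (simp add: A_def)
qed

text \<open>The ratio is \<open>1 + (2 * x + 1) / (y - x)\<close> and
  \<open>y - x \<ge> y / 2\<close>. With an exponent proportional to \<open>1 / y\<close>, products
  of such ratios are governed by sums of reciprocals.\<close>

lemma ratio_far_bound:
  fixes x y :: real
  assumes "x > 0" "2 * x \<le> y"
  shows "(x + y + 1) / \<bar>x - y\<bar> \<le> exp (2 * (2 * x + 1) / y)"
proof -
  have "(x + y + 1) / \<bar>x - y\<bar> = 1 + (2 * x + 1) / (y - x)"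
    using assms by (simp add: field_simps)
  also have "(2 * x + 1) / (y - x) \<le> (2 * x + 1) / (y / 2)"
    using assms by (intro divide_left_mono) auto
  also have "1 + (2 * x + 1) / (y / 2) \<le> exp ((2 * x + 1) / (y / 2))"
    by (rule exp_ge_add_one_self)
  finally show ?thesis by (simp add: mult.commute)
qed

text \<open>\<open>C\<close> is uniform in both indices: uniformity in \<open>N\<close> makes the
  dual functions converge, uniformity in \<open>n\<close> gives the growth rate of the
  limits.\<close>

lemma prod_ratio_bound:
  fixes \<Lambda> :: "nat \<Rightarrow> real"
  assumes mono: "strict_mono \<Lambda>" and pos: "\<And>n. \<Lambda> n > 0" and summ: "summable (\<lambda>n. 1 / \<Lambda> n)"
    and gap: "\<And>n. d \<le> \<Lambda> (Suc n) - \<Lambda> n" and d: "d > 0" and \<eta>: "\<eta> > 0"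
  shows "\<exists>C>0. \<forall>n N. n \<le> N \<longrightarrow>
    (\<Prod>m\<in>{..N}-{n}. (\<Lambda> n + \<Lambda> m + 1) / \<bar>\<Lambda> n - \<Lambda> m\<bar>) \<le> C * exp (\<eta> * \<Lambda> n)"
proof -
  \<comment> \<open>\<open>\<delta>\<close> and \<open>\<epsilon>\<close> are chosen so that each of the three terms linear in \<open>\<Lambda> n\<close> of the final exponent
     is at most \<open>\<eta> / 3 * \<Lambda> n\<close>.\<close>
  define \<delta> where "\<delta> = min (1/2) (\<eta> * d / 18)"
  have \<delta>: "0 < \<delta>" "\<delta> < 1" "\<delta> \<le> \<eta> * d / 18" using \<eta> d by (auto simp: \<delta>_def)
  define l where "l = - ln \<delta>"
  have l: "l > 0" using \<delta> by (simp add: l_def)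
  define \<epsilon> where "\<epsilon> = \<eta> / (6 * l + 12)"
  have \<epsilon>: "\<epsilon> > 0" using \<eta> l by (simp add: \<epsilon>_def)
  obtain M where M: "\<And>n. (\<Sum>k\<in>{M..<n}. 1 / \<Lambda> k) < \<epsilon>"
  proof -
    obtain M where "\<forall>m\<ge>M. \<forall>n. norm (\<Sum>k\<in>{m..<n}. 1 / \<Lambda> k) < \<epsilon>"
      using summ \<epsilon> unfolding summable_Cauchy by blast
    then have "norm (\<Sum>k\<in>{M..<n}. 1 / \<Lambda> k) < \<epsilon>" for n by blast
    then have "(\<Sum>k\<in>{M..<n}. 1 / \<Lambda> k) < \<epsilon>" for n
      unfolding real_norm_def abs_less_iff by blast
    then show ?thesis by (rule that)
  qed
  \<comment> \<open>The reciprocals decrease, so \<open>(K - M) / \<Lambda> K\<close> is at most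
    their sum from \<open>M\<close> to \<open>K - 1\<close>, hence below \<open>\<epsilon>\<close>.
    This is the precise form of "\<open>K\<close> is of smaller order than
    \<open>\<Lambda> K\<close>".\<close>
  have count: "real K \<le> real M + \<epsilon> * \<Lambda> K" for K
  proof (cases "K < M")
    case True
    moreover have "0 \<le> \<epsilon> * \<Lambda> K" using \<epsilon> pos[of K] by simp
    ultimately show ?thesis by linarith
  next
    case False
    have "(real K - real M) * (1 / \<Lambda> K) \<le> (\<Sum>k\<in>{M..<K}. 1 / \<Lambda> K)"
      using False by (simp add: of_nat_diff)
    also have "\<dots> \<le> (\<Sum>k\<in>{M..<K}. 1 / \<Lambda> k)"
      using pos strict_mono_less[OF mono] by (intro sum_mono divide_left_mono) (auto intro: less_imp_le)
    also have "\<dots> < \<epsilon>" by (rule M)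
    finally show ?thesis using pos[of K] by (simp add: field_simps)
  qed
  \<comment> \<open>\<open>c\<close> bounds the exponent of one far factor, using
    \<open>\<Lambda> m \<ge> 2 * \<Lambda> n\<close> and
    \<open>\<Lambda> m \<ge> \<Lambda> 0\<close>. It serves the at most \<open>M\<close> far indices
    below \<open>M\<close>, where the tail estimate does not apply.\<close>
  define c where "c = 2 + 2 / \<Lambda> 0"
  have c: "c > 0" using pos[of 0] by (simp add: c_def add_pos_pos)
  define C where "C = exp (2 * \<delta> / d + M * l + M * c + 2 * \<epsilon>)"
  have "(\<Prod>m\<in>{..N}-{n}. (\<Lambda> n + \<Lambda> m + 1) / \<bar>\<Lambda> n - \<Lambda> m\<bar>) \<le> C * exp (\<eta> * \<Lambda> n)" if nN: "n \<le> N" for n N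
  proof -
    let ?f = "\<lambda>m. (\<Lambda> n + \<Lambda> m + 1) / \<bar>\<Lambda> n - \<Lambda> m\<bar>"
    have x: "\<Lambda> n > 0" by (rule pos)
    have nonneg: "0 \<le> ?f m" for m
      using x pos[of m] by simp
    \<comment> \<open>The cut between near and far factors: by monotonicity the indices up to
      \<open>K\<close> are exactly those up to \<open>N\<close> with
      \<open>\<Lambda> m < 2 * \<Lambda> n\<close>. The set contains \<open>n\<close>, so the
      maximum exists.\<close>
    define K where "K = Max {m. m \<le> N \<and> \<Lambda> m < 2 * \<Lambda> n}"
    have S: "finite {m. m \<le> N \<and> \<Lambda> m < 2 * \<Lambda> n}" by simp
    have nS: "n \<in> {m. m \<le> N \<and> \<Lambda> m < 2 * \<Lambda> n}" using nN x by simp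
    have nK: "n \<le> K" unfolding K_def using S nS by (rule Max_ge)
    have "K \<in> {m. m \<le> N \<and> \<Lambda> m < 2 * \<Lambda> n}"
      unfolding K_def using S nS by (intro Max_in) auto
    then have K: "K \<le> N" "\<Lambda> K < 2 * \<Lambda> n" by auto
    have near: "\<Lambda> m < 2 * \<Lambda> n" if "m \<le> K" for m
      using that K(2) strict_mono_less_eq[OF mono, of m K] by linarith
    have far: "2 * \<Lambda> n \<le> \<Lambda> m" if "m \<in> {K<..N}" for m
      using Max_ge[OF S, of m] that unfolding K_def[symmetric] by force
    have "(\<Prod>m\<in>{..N}-{n}. ?f m) = (\<Prod>m\<in>({..K}-{n}) \<union> {K<..N}. ?f m)"
      using nK K by (intro prod.cong) auto
    also have "\<dots> = (\<Prod>m\<in>{..K}-{n}. ?f m) * (\<Prod>m\<in>{K<..N}. ?f m)"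
      by (intro prod.union_disjoint) auto
    also have "\<dots> \<le> exp (2 * ((3 * \<Lambda> n + 1) / d * \<delta>)) / \<delta> ^ K
        * exp (M * c + 2 * (2 * \<Lambda> n + 1) * \<epsilon>)"
    proof (rule mult_mono)
      show "(\<Prod>m\<in>{..K}-{n}. ?f m) \<le> exp (2 * ((3 * \<Lambda> n + 1) / d * \<delta>)) / \<delta> ^ K"
        by (rule prod_ratio_near_bound[OF gap d \<delta>(1) pos nK near])
      have "(\<Prod>m\<in>{K<..N}. ?f m) \<le> (\<Prod>m\<in>{K<..N}. exp (2 * (2 * \<Lambda> n + 1) / \<Lambda> m))"
        using far ratio_far_bound[OF x] nonneg by (intro prod_mono conjI) blast+
      also have "\<dots> = exp (\<Sum>m\<in>{K<..N}. 2 * (2 * \<Lambda> n + 1) / \<Lambda> m)"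
        by (simp add: exp_sum)
      also have "(\<Sum>m\<in>{K<..N}. 2 * (2 * \<Lambda> n + 1) / \<Lambda> m)
          \<le> (\<Sum>m\<in>{K<..N}. (if m < M then c else 0) + (if m \<ge> M then 2 * (2 * \<Lambda> n + 1) * (1 / \<Lambda> m) else 0))"
      proof (rule sum_mono)
        fix m assume m: "m \<in> {K<..N}"
        have "2 * (2 * \<Lambda> n + 1) / \<Lambda> m = 2 * (2 * \<Lambda> n / \<Lambda> m) + 2 / \<Lambda> m"
          by (simp add: add_divide_distrib)
        also have "\<dots> \<le> 2 * 1 + 2 / \<Lambda> 0"
          using far[OF m] pos[of m] pos[of 0] strict_mono_less_eq[OF mono, of 0 m]
          by (intro add_mono mult_left_mono divide_left_mono) auto
        finally show "2 * (2 * \<Lambda> n + 1) / \<Lambda> m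
            \<le> (if m < M then c else 0) + (if m \<ge> M then 2 * (2 * \<Lambda> n + 1) * (1 / \<Lambda> m) else 0)"
          by (simp add: c_def)
      qed
      also have "\<dots> = (\<Sum>m\<in>{K<..N}. if m < M then c else 0)
          + (\<Sum>m\<in>{K<..N}. if m \<ge> M then 2 * (2 * \<Lambda> n + 1) * (1 / \<Lambda> m) else 0)"
        by (rule sum.distrib)
      also have "(\<Sum>m\<in>{K<..N}. if m < M then c else 0) \<le> (\<Sum>m\<in>{..<M}. c)"
        using c by (subst sum.inter_filter[symmetric]) (auto intro!: sum_mono2 simp del: sum_constant)
      also have "(\<Sum>m\<in>{K<..N}. if m \<ge> M then 2 * (2 * \<Lambda> n + 1) * (1 / \<Lambda> m) else 0)
          \<le> (\<Sum>m\<in>{M..<Suc N}. 2 * (2 * \<Lambda> n + 1) * (1 / \<Lambda> m))"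
      proof (subst sum.inter_filter[symmetric])
        have "0 \<le> 2 * (2 * \<Lambda> n + 1) * (1 / \<Lambda> m)" for m
          using x pos[of m] by simp
        then show "(\<Sum>m\<in>{m \<in> {K<..N}. M \<le> m}. 2 * (2 * \<Lambda> n + 1) * (1 / \<Lambda> m))
            \<le> (\<Sum>m\<in>{M..<Suc N}. 2 * (2 * \<Lambda> n + 1) * (1 / \<Lambda> m))"
          by (intro sum_mono2) auto
      qed simp
      also have "\<dots> = 2 * (2 * \<Lambda> n + 1) * (\<Sum>m\<in>{M..<Suc N}. 1 / \<Lambda> m)"
        by (simp only: sum_distrib_left)
      also have "\<dots> \<le> 2 * (2 * \<Lambda> n + 1) * \<epsilon>"
        using M[of "Suc N"] x by (intro mult_left_mono) auto
      finally show "(\<Prod>m\<in>{K<..N}. ?f m) \<le> exp (M * c + 2 * (2 * \<Lambda> n + 1) * \<epsilon>)"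
        by simp
      show "0 \<le> exp (2 * ((3 * \<Lambda> n + 1) / d * \<delta>)) / \<delta> ^ K"
        using \<delta> by simp
      show "0 \<le> (\<Prod>m\<in>{K<..N}. ?f m)"
        using nonneg by (rule prod_nonneg)
    qed
    also have "1 / \<delta> ^ K = exp (K * l)"
      using \<delta> by (simp add: l_def exp_minus exp_of_nat_mult inverse_eq_divide power_one_over)
    then have "exp (2 * ((3 * \<Lambda> n + 1) / d * \<delta>)) / \<delta> ^ K * exp (M * c + 2 * (2 * \<Lambda> n + 1) * \<epsilon>)
      = exp (2 * ((3 * \<Lambda> n + 1) / d * \<delta>) + K * l + (M * c + 2 * (2 * \<Lambda> n + 1) * \<epsilon>))"
      by (simp add: exp_add divide_inverse)
    also have "\<dots> \<le> exp ((2 * \<delta> / d + M * l + M * c + 2 * \<epsilon>) + \<eta> * \<Lambda> n)"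
    proof -
      have "6 * \<delta> / d \<le> \<eta> / 3"
        using \<delta>(3) d by (simp add: field_simps)
      then have 1: "(6 * \<delta> / d) * \<Lambda> n \<le> (\<eta> / 3) * \<Lambda> n"
        using x by (intro mult_right_mono) auto
      have "2 * \<epsilon> * l \<le> \<eta> / 3"
        using l \<eta> by (simp add: \<epsilon>_def field_simps)
      then have 2: "(2 * \<epsilon> * l) * \<Lambda> n \<le> (\<eta> / 3) * \<Lambda> n"
        using x by (intro mult_right_mono) auto
      have "4 * \<epsilon> \<le> \<eta> / 3"
        using l \<eta> by (simp add: \<epsilon>_def field_simps)
      then have 3: "(4 * \<epsilon>) * \<Lambda> n \<le> (\<eta> / 3) * \<Lambda> n"
        using x by (intro mult_right_mono) auto
      \<comment> \<open>The defining property of \<open>K\<close> converts the count in terms of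
        \<open>\<Lambda> K\<close> into one in terms of \<open>\<Lambda> n\<close>, at the cost of a
        factor 2.\<close>
      have "real K \<le> M + \<epsilon> * (2 * \<Lambda> n)"
      proof -
        have "\<epsilon> * \<Lambda> K \<le> \<epsilon> * (2 * \<Lambda> n)"
          using K(2) \<epsilon> by (intro mult_left_mono) auto
        then show ?thesis using count[of K] by linarith
      qed
      then have "K * l \<le> (M + \<epsilon> * (2 * \<Lambda> n)) * l"
        using l by (intro mult_right_mono) auto
      also have "\<dots> = M * l + (2 * \<epsilon> * l) * \<Lambda> n"
        by (simp add: algebra_simps)
      finally have 4: "K * l \<le> M * l + (2 * \<epsilon> * l) * \<Lambda> n" .
      have 5: "2 * ((3 * \<Lambda> n + 1) / d * \<delta>) = (6 * \<delta> / d) * \<Lambda> n + 2 * \<delta> / d"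
        using d by (simp add: field_simps)
      have 6: "2 * (2 * \<Lambda> n + 1) * \<epsilon> = (4 * \<epsilon>) * \<Lambda> n + 2 * \<epsilon>"
        by (simp add: algebra_simps)
      have 7: "(\<eta> / 3) * \<Lambda> n + (\<eta> / 3) * \<Lambda> n + (\<eta> / 3) * \<Lambda> n = \<eta> * \<Lambda> n"
        by simp
      have "2 * ((3 * \<Lambda> n + 1) / d * \<delta>) + K * l + (M * c + 2 * (2 * \<Lambda> n + 1) * \<epsilon>)
        \<le> (2 * \<delta> / d + M * l + M * c + 2 * \<epsilon>) + \<eta> * \<Lambda> n"
        using 1 2 3 4 unfolding 5 6 7[symmetric] by linarith
      then show ?thesis by simp
    qed
    also have "\<dots> = C * exp (\<eta> * \<Lambda> n)"
      by (simp add: C_def exp_add)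
    finally show ?thesis .
  qed
  then show ?thesis
    by (intro exI[of _ C]) (auto simp: C_def)
qed

section \<open>The dual system\<close>

text \<open>
  The first quotient is the constant \<open>c\<close> of the rational function above; the second is the residue
  of \<open>R / c\<close> at \<open>- (\<Lambda> k + 1)\<close>.
\<close>

definition dual_coeff :: "(nat \<Rightarrow> real) \<Rightarrow> nat \<Rightarrow> nat \<Rightarrow> nat \<Rightarrow> real" where
  "dual_coeff \<Lambda> N n k =
     (\<Prod>j\<le>N. \<Lambda> n + \<Lambda> j + 1) / (\<Prod>m\<in>{..N}-{n}. \<Lambda> n - \<Lambda> m)
     * ((\<Prod>m\<in>{..N}-{n}. - (\<Lambda> k + 1) - \<Lambda> m) / (\<Prod>j\<in>{..N}-{k}. \<Lambda> j - \<Lambda> k))"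

text \<open>The sum is the partial fraction expansion of the rational function with poles
  \<open>- (\<Lambda> k + 1)\<close>, evaluated at \<open>\<Lambda> m\<close>. Its numerator
  vanishes at every \<open>\<Lambda> m\<close> with \<open>m \<noteq> n\<close>,
  \<open>m \<le> N\<close>, and \<open>c\<close> normalises the value at
  \<open>\<Lambda> n\<close>.\<close>

lemma sum_dual_coeff:
  assumes mono: "strict_mono \<Lambda>" and pos: "\<And>n. \<Lambda> n > 0" and "m \<le> N" "n \<le> N"
  shows "(\<Sum>k\<le>N. dual_coeff \<Lambda> N n k / (\<Lambda> m + \<Lambda> k + 1)) = (if m = n then 1 else 0)"
proof -
  define p where "p = (\<Prod>m\<in>{..N}-{n}. [:- \<Lambda> m, 1:])"
  define x where "x k = - (\<Lambda> k + 1)" for k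
  define c where "c = (\<Prod>j\<le>N. \<Lambda> n + \<Lambda> j + 1) / (\<Prod>m\<in>{..N}-{n}. \<Lambda> n - \<Lambda> m)"
  have poly_p: "poly p s = (\<Prod>m\<in>{..N}-{n}. s - \<Lambda> m)" for s
    by (simp add: p_def poly_prod)
  have inj: "\<Lambda> i = \<Lambda> j \<longleftrightarrow> i = j" for i j
    using strict_mono_eq[OF mono] .
  have "degree p \<le> (\<Sum>m\<in>{..N}-{n}. 1)"
    unfolding p_def using degree_prod_sum_le[of "{..N} - {n}" "\<lambda>m. [:- \<Lambda> m, 1:]"] by (simp add: comp_def)
  then have deg: "degree p < card {..N}"
    using \<open>n \<le> N\<close> by simp
  have s: "\<Lambda> m \<notin> x ` {..N}"
  proof
    assume "\<Lambda> m \<in> x ` {..N}"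
    then obtain k where "\<Lambda> m = - (\<Lambda> k + 1)" by (auto simp: x_def)
    then show False using pos[of m] pos[of k] by simp
  qed
  have "(\<Sum>k\<le>N. dual_coeff \<Lambda> N n k / (\<Lambda> m + \<Lambda> k + 1))
      = c * (\<Sum>k\<le>N. poly p (x k) / (\<Prod>j\<in>{..N}-{k}. x k - x j) / (\<Lambda> m - x k))"
    by (simp add: dual_coeff_def c_def poly_p x_def sum_distrib_left algebra_simps)
  also have "(\<Sum>k\<le>N. poly p (x k) / (\<Prod>j\<in>{..N}-{k}. x k - x j) / (\<Lambda> m - x k))
      = poly p (\<Lambda> m) / (\<Prod>j\<le>N. \<Lambda> m - x j)"
    using deg s by (intro partial_fractions) (auto simp: inj_on_def x_def inj)
  also have "c * \<dots> = (if m = n then 1 else 0)"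
  proof (cases "m = n")
    case True
    have "(\<Prod>j\<le>N. \<Lambda> n + \<Lambda> j + 1) \<noteq> 0" 
      using pos by (auto simp: add_pos_pos less_imp_neq[symmetric])
    moreover have "(\<Prod>m\<in>{..N}-{n}. \<Lambda> n - \<Lambda> m) \<noteq> 0"
      by (auto simp: inj)
    moreover have "(\<Prod>j\<le>N. \<Lambda> m - x j) = (\<Prod>j\<le>N. \<Lambda> n + \<Lambda> j + 1)"
      by (simp add: x_def True algebra_simps)
    ultimately show ?thesis
      by (simp add: c_def poly_p True)
  next
    case False
    then have "poly p (\<Lambda> m) = 0"
      using \<open>m \<le> N\<close> by (auto simp: poly_p)
    then show ?thesis using False by simp
  qed
  finally show ?thesis .
qed

text \<open>For \<open>k = n\<close> the signs in the second quotient cancel factor by factor,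
  leaving the first quotient without its factor \<open>2 * \<Lambda> n + 1\<close>. The square then
  absorbs the signs of \<open>\<Lambda> n - \<Lambda> m\<close>.\<close>

lemma dual_coeff_diagonal:
  assumes "n \<le> N"
  shows "dual_coeff \<Lambda> N n n =
    (2 * \<Lambda> n + 1) * (\<Prod>m\<in>{..N}-{n}. (\<Lambda> n + \<Lambda> m + 1) / \<bar>\<Lambda> n - \<Lambda> m\<bar>)\<^sup>2"
proof -
  let ?P = "\<Prod>m\<in>{..N}-{n}. \<Lambda> n + \<Lambda> m + 1" and ?Q = "\<Prod>m\<in>{..N}-{n}. \<Lambda> n - \<Lambda> m"
  have "(\<Prod>j\<le>N. \<Lambda> n + \<Lambda> j + 1) = (2 * \<Lambda> n + 1) * ?P"
    using assms by (subst prod.remove[of _ n]) auto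
  moreover have "(\<Prod>m\<in>{..N}-{n}. - (\<Lambda> n + 1) - \<Lambda> m) / (\<Prod>j\<in>{..N}-{n}. \<Lambda> j - \<Lambda> n) = ?P / ?Q"
    unfolding prod_dividef[symmetric]
  proof (rule prod.cong)
    fix m
    have "(- (\<Lambda> n + 1) - \<Lambda> m) / (\<Lambda> m - \<Lambda> n) = (- (\<Lambda> n + \<Lambda> m + 1)) / (- (\<Lambda> n - \<Lambda> m))"
      by (simp add: algebra_simps)
    then show "(- (\<Lambda> n + 1) - \<Lambda> m) / (\<Lambda> m - \<Lambda> n) = (\<Lambda> n + \<Lambda> m + 1) / (\<Lambda> n - \<Lambda> m)"
      by (simp only: minus_divide_divide)
  qed simp
  ultimately have "dual_coeff \<Lambda> N n n = (2 * \<Lambda> n + 1) * (?P / ?Q)\<^sup>2"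
    by (simp add: dual_coeff_def power2_eq_square)
  also have "(?P / ?Q)\<^sup>2 = (\<Prod>m\<in>{..N}-{n}. (\<Lambda> n + \<Lambda> m + 1) / \<bar>\<Lambda> n - \<Lambda> m\<bar>)\<^sup>2"
    by (simp add: prod_dividef power_divide flip: abs_prod)
  finally show ?thesis .
qed

section \<open>Powers and their finite dual functions in the Hilbert space\<close>

lemma powr_integral_leb01:
  assumes "a > -1"
  shows "integrable leb01 (\<lambda>t. t powr a)" "(LINT t|leb01. t powr a) = 1 / (a + 1)"
proof -
  have I: "((\<lambda>t::real. t powr a) has_integral 1 / (a + 1)) {0<..<1}"
    using has_integral_powr_from_0[OF assms, of 1]
    by (simp add: has_integral_Icc_iff_Ioo)
  then have "(\<lambda>t::real. t powr a) absolutely_integrable_on {0<..<1}"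
    by (intro nonnegative_absolutely_integrable_1) (auto simp: integrable_on_def)
  then show i: "integrable leb01 (\<lambda>t. t powr a)"
    by (subst integrable_restrict_space) (auto simp: set_integrable_def)
  show "(LINT t|leb01. t powr a) = 1 / (a + 1)"
    using I i by (simp add: lebesgue_integral_eq_integral integral_unique)
qed

lemma power_fun_L2:
  assumes "\<Lambda> n > 0"
  shows "power_fun \<Lambda> n \<in> L2_01"
proof -
  have "(\<lambda>t. complex_of_real (t powr \<Lambda> n)) \<in> borel_measurable leb01"
    using borel_measurable_integrable[OF powr_integral_leb01(1)[of "\<Lambda> n"]] assms by simp
  moreover have "(\<lambda>t::real. (t powr \<Lambda> n)\<^sup>2) = (\<lambda>t. t powr (\<Lambda> n + \<Lambda> n))"
    unfolding power2_eq_square powr_add ..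
  then have "integrable leb01 (\<lambda>t. (t powr \<Lambda> n)\<^sup>2)"
    using powr_integral_leb01(1)[of "\<Lambda> n + \<Lambda> n"] assms by simp
  ultimately show ?thesis
    by (simp add: L2_01_def power_fun_def[abs_def])
qed

lemma L2_inner_power_fun:
  assumes "\<Lambda> m > 0" "\<Lambda> n > 0"
  shows "L2_inner (power_fun \<Lambda> m) (power_fun \<Lambda> n) = complex_of_real (1 / (\<Lambda> m + \<Lambda> n + 1))"
proof -
  have "L2_inner (power_fun \<Lambda> m) (power_fun \<Lambda> n) = (LINT t|leb01. complex_of_real (t powr (\<Lambda> m + \<Lambda> n)))"
    by (simp add: L2_inner_def power_fun_def powr_add)
  also have "\<dots> = complex_of_real (1 / (\<Lambda> m + \<Lambda> n + 1))"
    using powr_integral_leb01(2)[of "\<Lambda> m + \<Lambda> n"] assms by (simp only: integral_complex_of_real)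
  finally show ?thesis .
qed

definition dual_fun :: "(nat \<Rightarrow> real) \<Rightarrow> nat \<Rightarrow> nat \<Rightarrow> real \<Rightarrow> complex" where
  "dual_fun \<Lambda> N n t = (\<Sum>k\<le>N. complex_of_real (dual_coeff \<Lambda> N n k) * power_fun \<Lambda> k t)"

lemma dual_fun_L2:
  assumes "\<And>n. \<Lambda> n > 0"
  shows "dual_fun \<Lambda> N n \<in> L2_01"
  unfolding dual_fun_def[abs_def] using assms by (intro L2_01_sum L2_01_cmult power_fun_L2)

lemma dual_fun_span:
  assumes "strict_mono \<Lambda>"
  shows "dual_fun \<Lambda> N n \<in> complex_span (range (power_fun \<Lambda>))"
proof -
  \<comment> \<open>Coefficients in \<open>complex_span\<close> are attached to functions, not
    indices, so distinct indices must give distinct powers; the value at 1/2 already separates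
    them.\<close>
  have inj: "inj (power_fun \<Lambda>)"
  proof (rule injI)
    fix i j assume "power_fun \<Lambda> i = power_fun \<Lambda> j"
    then have "power_fun \<Lambda> i (1/2) = power_fun \<Lambda> j (1/2)" by simp
    then have "(1/2::real) powr \<Lambda> i = (1/2) powr \<Lambda> j" 
      by (simp add: power_fun_def del: powr_divide)
    then have "\<Lambda> i = \<Lambda> j"
      by (subst (asm) powr_inj) auto
    then show "i = j" using strict_mono_eq[OF assms] by simp
  qed
  then have "dual_fun \<Lambda> N n = (\<lambda>t. \<Sum>g\<in>power_fun \<Lambda> ` {..N}.
      complex_of_real (dual_coeff \<Lambda> N n (inv (power_fun \<Lambda>) g)) * g t)"
    by (simp add: dual_fun_def[abs_def] sum.reindex inj_on_subset[OF inj])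
  then show ?thesis
    unfolding complex_span_def mem_Collect_eq
    by (intro exI[of _ "power_fun \<Lambda> ` {..N}"] exI conjI) auto
qed

lemma L2_inner_power_dual:
  assumes mono: "strict_mono \<Lambda>" and pos: "\<And>n. \<Lambda> n > 0" and "m \<le> N" "n \<le> N"
  shows "L2_inner (power_fun \<Lambda> m) (dual_fun \<Lambda> N n) = (if m = n then 1 else 0)"
proof -
  have "L2_inner (dual_fun \<Lambda> N n) (power_fun \<Lambda> m)
      = (\<Sum>k\<le>N. complex_of_real (dual_coeff \<Lambda> N n k) * L2_inner (power_fun \<Lambda> k) (power_fun \<Lambda> m))"
    unfolding dual_fun_def[abs_def] using pos by (intro L2_inner_sum_left power_fun_L2)
  also have "\<dots> = complex_of_real (\<Sum>k\<le>N. dual_coeff \<Lambda> N n k / (\<Lambda> m + \<Lambda> k + 1))"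
    using pos by (simp add: L2_inner_power_fun add_ac)
  also have "\<dots> = (if m = n then 1 else 0)"
    by (simp only: sum_dual_coeff[OF assms]) simp
  finally show ?thesis
    by (subst L2_inner_commute) simp
qed

text \<open>Expand the function of smaller index in the powers \<open>k \<le> N\<close>: the other
  one pairs to 0 with all of them but the \<open>n\<close>-th, so only the coefficient at
  \<open>n\<close> survives.\<close>

lemma L2_inner_dual_dual:
  assumes mono: "strict_mono \<Lambda>" and pos: "\<And>n. \<Lambda> n > 0" and "n \<le> N" "N \<le> M"
  shows "L2_inner (dual_fun \<Lambda> N n) (dual_fun \<Lambda> M n) = complex_of_real (dual_coeff \<Lambda> N n n)"
proof -
  have "L2_inner (dual_fun \<Lambda> N n) (dual_fun \<Lambda> M n)
      = (\<Sum>k\<le>N. complex_of_real (dual_coeff \<Lambda> N n k) * L2_inner (power_fun \<Lambda> k) (dual_fun \<Lambda> M n))"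
    unfolding dual_fun_def[of \<Lambda> N, abs_def] using pos by (intro L2_inner_sum_left power_fun_L2 dual_fun_L2)
  also have "\<dots> = (\<Sum>k\<le>N. if k = n then complex_of_real (dual_coeff \<Lambda> N n n) else 0)"
    using assms by (intro sum.cong) (auto simp: L2_inner_power_dual[OF mono pos])
  also have "\<dots> = complex_of_real (dual_coeff \<Lambda> N n n)"
    using \<open>n \<le> N\<close> by simp
  finally show ?thesis .
qed

lemma L2_norm_dual_fun:
  assumes mono: "strict_mono \<Lambda>" and pos: "\<And>n. \<Lambda> n > 0" and "n \<le> N"
  shows "(L2_norm01 (dual_fun \<Lambda> N n))\<^sup>2 = dual_coeff \<Lambda> N n n"
  using L2_inner_dual_dual[OF mono pos \<open>n \<le> N\<close> order_refl]
  unfolding L2_inner_self of_real_eq_iff .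

text \<open>Pythagoras: the inner product of the two functions is the squared norm of the one of
  smaller index, so that one is orthogonal to the difference.\<close>

lemma L2_norm_dual_fun_diff:
  assumes mono: "strict_mono \<Lambda>" and pos: "\<And>n. \<Lambda> n > 0" and "n \<le> N" "N \<le> M"
  shows "(L2_norm01 (\<lambda>t. dual_fun \<Lambda> M n t - dual_fun \<Lambda> N n t))\<^sup>2 = dual_coeff \<Lambda> M n n - dual_coeff \<Lambda> N n n"
proof -
  note L = dual_fun_L2[of \<Lambda>, OF pos]
  note I = L2_inner_dual_dual[OF mono pos]
  have "L2_inner (dual_fun \<Lambda> M n) (dual_fun \<Lambda> N n) = complex_of_real (dual_coeff \<Lambda> N n n)"
    using assms by (subst L2_inner_commute) (simp add: I)
  then have "L2_inner (\<lambda>t. dual_fun \<Lambda> M n t - dual_fun \<Lambda> N n t) (\<lambda>t. dual_fun \<Lambda> M n t - dual_fun \<Lambda> N n t)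
      = complex_of_real (dual_coeff \<Lambda> M n n - dual_coeff \<Lambda> N n n)"
    using assms by (simp add: L2_inner_diff_left L2_inner_diff_right L L2_01_diff I)
  then show ?thesis
    unfolding L2_inner_self of_real_eq_iff .
qed

lemma L2_norm_dual_fun_bound:
  assumes mono: "strict_mono \<Lambda>" and pos: "\<And>n. \<Lambda> n > 0" and summ: "summable (\<lambda>n. 1 / \<Lambda> n)"
    and gap: "\<And>n. d \<le> \<Lambda> (Suc n) - \<Lambda> n" "d > 0" and \<epsilon>: "\<epsilon> > 0"
  shows "\<exists>m>0. \<forall>n N. n \<le> N \<longrightarrow> L2_norm01 (dual_fun \<Lambda> N n) \<le> m * (1 + \<epsilon>) powr \<Lambda> n"
proof -
  \<comment> \<open>Half of the rate \<open>ln (1 + \<epsilon>)\<close> pays for the product, the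
    other half for the factor \<open>2 * \<Lambda> n + 1\<close>.\<close>
  define \<eta> where "\<eta> = ln (1 + \<epsilon>) / 2"
  have \<eta>: "\<eta> > 0" using \<epsilon> by (simp add: \<eta>_def)
  obtain C where C: "C > 0" and bound: "\<And>n N. n \<le> N \<Longrightarrow>
      (\<Prod>m\<in>{..N}-{n}. (\<Lambda> n + \<Lambda> m + 1) / \<bar>\<Lambda> n - \<Lambda> m\<bar>) \<le> C * exp (\<eta> * \<Lambda> n)"
    using prod_ratio_bound[OF mono pos summ gap \<eta>] by blast
  have "L2_norm01 (dual_fun \<Lambda> N n) \<le> ((1 + 2 / \<eta>) * C) * (1 + \<epsilon>) powr \<Lambda> n" if "n \<le> N" for n N
  proof -
    define P where "P = (\<Prod>m\<in>{..N}-{n}. (\<Lambda> n + \<Lambda> m + 1) / \<bar>\<Lambda> n - \<Lambda> m\<bar>)"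
    have x: "\<Lambda> n > 0" by (rule pos)
    have "0 \<le> (\<Lambda> n + \<Lambda> m + 1) / \<bar>\<Lambda> n - \<Lambda> m\<bar>" for m
      using x pos[of m] by simp
    then have P: "P \<ge> 0" unfolding P_def by (rule prod_nonneg)
    have "(L2_norm01 (dual_fun \<Lambda> N n))\<^sup>2 = (2 * \<Lambda> n + 1) * P\<^sup>2"
      using that by (simp add: L2_norm_dual_fun[OF mono pos] dual_coeff_diagonal P_def)
    \<comment> \<open>Enlarging the factor, which is at least 1, to its square avoids a square
      root.\<close>
    also have "\<dots> \<le> (2 * \<Lambda> n + 1)\<^sup>2 * P\<^sup>2"
      using x by (intro mult_right_mono) (auto simp: power2_eq_square)
    also have "\<dots> = ((2 * \<Lambda> n + 1) * P)\<^sup>2"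
      by (simp add: power_mult_distrib)
    finally have "L2_norm01 (dual_fun \<Lambda> N n) \<le> (2 * \<Lambda> n + 1) * P"
      using x P by (auto dest: power2_le_imp_le)
    also have "\<dots> \<le> ((1 + 2 / \<eta>) * exp (\<eta> * \<Lambda> n)) * (C * exp (\<eta> * \<Lambda> n))"
    proof (rule mult_mono)
      have "2 * \<Lambda> n + 1 \<le> (1 + 2 / \<eta>) * (1 + \<eta> * \<Lambda> n)"
        using x \<eta> by (simp add: algebra_simps)
      also have "\<dots> \<le> (1 + 2 / \<eta>) * exp (\<eta> * \<Lambda> n)"
        using \<eta> by (intro mult_left_mono) auto
      finally show "2 * \<Lambda> n + 1 \<le> (1 + 2 / \<eta>) * exp (\<eta> * \<Lambda> n)" .
      show "P \<le> C * exp (\<eta> * \<Lambda> n)" using bound[OF that] by (simp add: P_def)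
    qed (use P \<eta> in auto)
    also have "\<dots> = ((1 + 2 / \<eta>) * C) * exp (\<eta> * \<Lambda> n + \<eta> * \<Lambda> n)"
      unfolding exp_add by (simp only: mult_ac)
    also have "exp (\<eta> * \<Lambda> n + \<eta> * \<Lambda> n) = (1 + \<epsilon>) powr \<Lambda> n"
      using \<epsilon> by (simp add: powr_def \<eta>_def mult.commute)
    finally show ?thesis .
  qed
  then show ?thesis
    using C \<eta> by (intro exI[of _ "(1 + 2 / \<eta>) * C"]) (auto simp: add_pos_pos)
qed

section \<open>Passage to the limit, and orthogonality to a closed span\<close>

lemma dual_limit:
  assumes mono: "strict_mono \<Lambda>" and pos: "\<And>n. \<Lambda> n > 0"
    and B: "\<And>N. n \<le> N \<Longrightarrow> L2_norm01 (dual_fun \<Lambda> N n) \<le> B"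
  shows "\<exists>r\<in>L2_closed_span (range (power_fun \<Lambda>)).
    (\<forall>m. L2_inner (power_fun \<Lambda> m) r = (if m = n then 1 else 0)) \<and>
    (\<forall>b. (\<forall>N\<ge>n. L2_norm01 (dual_fun \<Lambda> N n) \<le> b) \<longrightarrow> L2_norm01 r \<le> b)"
proof -
  \<comment> \<open>The shift by \<open>n\<close> ensures that every member is dual to the
    \<open>n\<close>-th power. Squared distances are differences of the increasing bounded sequence
    \<open>a\<close>, so \<open>f\<close> is Cauchy.\<close>
  define f where "f j = dual_fun \<Lambda> (n + j) n" for j
  define a where "a j = dual_coeff \<Lambda> (n + j) n n" for j
  have f: "f j \<in> L2_01" for j
    unfolding f_def using pos by (rule dual_fun_L2)
  have diff: "(L2_norm01 (\<lambda>t. f j t - f i t))\<^sup>2 = a j - a i" if "i \<le> j" for i j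
    unfolding f_def a_def using that by (intro L2_norm_dual_fun_diff[OF mono pos]) auto
  have "incseq a"
  proof (rule incseq_SucI)
    fix j show "a j \<le> a (Suc j)"
      using diff[of j "Suc j"] zero_le_power2[of "L2_norm01 (\<lambda>t. f (Suc j) t - f j t)"] by linarith
  qed
  moreover have "a j \<le> B\<^sup>2" for j
    using power_mono[OF B[of "n + j"] L2_norm01_nonneg, of 2] L2_norm_dual_fun[OF mono pos, of n "n + j"]
    by (simp add: a_def)
  ultimately have "Cauchy a"
    using incseq_convergent LIMSEQ_imp_Cauchy by blast
  have "\<exists>N. \<forall>i\<ge>N. \<forall>j\<ge>N. L2_norm01 (\<lambda>t. f i t - f j t) \<le> e" if e: "e > 0" for e
  proof -
    obtain N where N: "\<And>i j. i \<ge> N \<Longrightarrow> j \<ge> N \<Longrightarrow> \<bar>a i - a j\<bar> < e\<^sup>2"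
      using \<open>Cauchy a\<close> e unfolding Cauchy_iff real_norm_def by (meson zero_less_power)
    have *: "L2_norm01 (\<lambda>t. f j t - f i t) \<le> e" if "N \<le> i" "i \<le> j" for i j
    proof -
      have "(L2_norm01 (\<lambda>t. f j t - f i t))\<^sup>2 \<le> e\<^sup>2"
        using diff[OF that(2)] N[of j i] that by simp
      then show ?thesis using e by (auto dest: power2_le_imp_le)
    qed
    have "L2_norm01 (\<lambda>t. f i t - f j t) \<le> e" if "N \<le> i" "N \<le> j" for i j
      using *[of i j] *[of j i] that by (cases "i \<le> j") (auto simp: L2_norm01_minus_commute[of "f i"])
    then show ?thesis by blast
  qed
  then obtain r where r: "r \<in> L2_01" and lim: "(\<lambda>j. L2_norm01 (\<lambda>t. r t - f j t)) \<longlonglongrightarrow> 0"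
    using L2_complete[of f] f by blast
  have "\<exists>p\<in>complex_span (range (power_fun \<Lambda>)). L2_norm01 (\<lambda>t. r t - p t) < \<delta>" if "\<delta> > 0" for \<delta>
  proof -
    have "\<forall>\<^sub>F j in sequentially. L2_norm01 (\<lambda>t. r t - f j t) < \<delta>"
      using lim that by (rule order_tendstoD)
    then obtain j where "L2_norm01 (\<lambda>t. r t - f j t) < \<delta>"
      by (auto simp: eventually_sequentially)
    moreover have "f j \<in> complex_span (range (power_fun \<Lambda>))"
      unfolding f_def using mono by (rule dual_fun_span)
    ultimately show ?thesis by blast
  qed
  with r have span: "r \<in> L2_closed_span (range (power_fun \<Lambda>))"
    by (simp add: L2_closed_span_def)
  have inner: "L2_inner (power_fun \<Lambda> m) r = (if m = n then 1 else 0)" for m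
  proof -
    have e: "power_fun \<Lambda> m \<in> L2_01" using pos by (rule power_fun_L2)
    have "(\<lambda>j. L2_inner (power_fun \<Lambda> m) r - L2_inner (power_fun \<Lambda> m) (f j)) \<longlonglongrightarrow> 0"
    proof (rule Lim_null_comparison)
      show "\<forall>\<^sub>F j in sequentially. norm (L2_inner (power_fun \<Lambda> m) r - L2_inner (power_fun \<Lambda> m) (f j))
          \<le> L2_norm01 (power_fun \<Lambda> m) * L2_norm01 (\<lambda>t. r t - f j t)"
        using L2_Cauchy_Schwarz[OF e L2_01_diff[OF r f]]
        by (simp add: L2_inner_diff_right[OF r f e])
      show "(\<lambda>j. L2_norm01 (power_fun \<Lambda> m) * L2_norm01 (\<lambda>t. r t - f j t)) \<longlonglongrightarrow> 0"
        using tendsto_mult_left[OF lim] by simp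
    qed
    \<comment> \<open>The inner products with \<open>f j\<close> are constant from
      \<open>j = m\<close> on, since then \<open>m \<le> n + j\<close>.\<close>
    moreover have "\<forall>\<^sub>F j in sequentially. L2_inner (power_fun \<Lambda> m) r - L2_inner (power_fun \<Lambda> m) (f j)
        = L2_inner (power_fun \<Lambda> m) r - (if m = n then 1 else 0)"
      using eventually_ge_at_top[of m]
    proof eventually_elim
      case (elim j)
      then show ?case
        unfolding f_def by (subst L2_inner_power_dual[OF mono pos]) auto
    qed
    ultimately have "(\<lambda>j::nat. L2_inner (power_fun \<Lambda> m) r - (if m = n then 1 else 0)) \<longlonglongrightarrow> 0"
      by (rule Lim_transform_eventually)
    then show ?thesis
      by (simp add: LIMSEQ_const_iff)
  qed
  \<comment> \<open>Letting \<open>b\<close> vary allows one fixed limit \<open>r\<close> to inherit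
    the bounds for all \<open>\<epsilon>\<close>.\<close>
  have norm: "L2_norm01 r \<le> b" if b: "\<forall>N\<ge>n. L2_norm01 (dual_fun \<Lambda> N n) \<le> b" for b
  proof -
    have "L2_norm01 r \<le> L2_norm01 (\<lambda>t. r t - f j t) + b" for j
    proof -
      have "L2_norm01 r \<le> L2_norm01 (\<lambda>t. r t - f j t) + L2_norm01 (f j)"
        using L2_01_add(2)[OF L2_01_diff[OF r f] f, of j j] by simp
      also have "L2_norm01 (f j) \<le> b" unfolding f_def using b by simp
      finally show ?thesis by simp
    qed
    moreover have "(\<lambda>j. L2_norm01 (\<lambda>t. r t - f j t) + b) \<longlonglongrightarrow> 0 + b"
      by (intro tendsto_add lim tendsto_const)
    ultimately show ?thesis
      using LIMSEQ_le_const by fastforce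
  qed
  show ?thesis using span inner norm by blast
qed

text \<open>Orthogonality extends to finite combinations by linearity and to their limits by
  Cauchy-Schwarz.\<close>

lemma closed_span_orthogonal:
  assumes S: "S \<subseteq> L2_01" and f: "f \<in> L2_closed_span S" and h: "h \<in> L2_01"
    and orth: "\<And>g. g \<in> S \<Longrightarrow> L2_inner g h = 0"
  shows "L2_inner f h = 0"
proof -
  have fL: "f \<in> L2_01" using f by (simp add: L2_closed_span_def)
  have "cmod (L2_inner f h) \<le> 0 + e" if e: "e > 0" for e
  proof -
    \<comment> \<open>The summand 1 keeps the denominator positive when \<open>h\<close> has norm
      0.\<close>
    define \<delta> where "\<delta> = e / (L2_norm01 h + 1)"
    have h1: "L2_norm01 h + 1 > 0" using L2_norm01_nonneg[of h] by simp
    then have "\<delta> > 0" using e by (simp add: \<delta>_def)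
    then obtain p where p: "p \<in> complex_span S" "L2_norm01 (\<lambda>t. f t - p t) < \<delta>"
      using f by (auto simp: L2_closed_span_def)
    obtain F c where F: "finite F" "F \<subseteq> S" and p_eq: "p = (\<lambda>t. \<Sum>g\<in>F. c g * g t)"
      using p(1) by (auto simp: complex_span_def)
    have FL: "g \<in> L2_01" if "g \<in> F" for g using that F S by blast
    have pL: "p \<in> L2_01"
      unfolding p_eq using FL by (intro L2_01_sum L2_01_cmult)
    have "L2_inner p h = (\<Sum>g\<in>F. c g * L2_inner g h)"
      unfolding p_eq using FL h by (rule L2_inner_sum_left)
    also have "\<dots> = 0" using orth F by (intro sum.neutral) auto
    finally have "L2_inner f h = L2_inner (\<lambda>t. f t - p t) h"
      by (simp add: L2_inner_diff_left[OF fL pL h])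
    then have "cmod (L2_inner f h) \<le> L2_norm01 (\<lambda>t. f t - p t) * L2_norm01 h"
      using L2_Cauchy_Schwarz[OF L2_01_diff[OF fL pL] h] by simp
    also have "\<dots> \<le> \<delta> * (L2_norm01 h + 1)"
      using p(2) L2_norm01_nonneg[of h] L2_norm01_nonneg[of "\<lambda>t. f t - p t"] by (intro mult_mono) auto
    also have "\<dots> = e" using h1 by (simp add: \<delta>_def)
    finally show ?thesis by simp
  qed
  then have "cmod (L2_inner f h) \<le> 0" by (rule field_le_epsilon)
  then show ?thesis by simp
qed

theorem lemma2p3:
  fixes \<Lambda> :: "nat \<Rightarrow> real"
  assumes "strict_mono \<Lambda>"
    and "\<And>n. \<Lambda> n > 0"
    and "summable (\<lambda>n. 1 / \<Lambda> n)"
    and "(INF n. \<Lambda> (Suc n) - \<Lambda> n) > 0"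
  shows "\<exists>r :: nat \<Rightarrow> real \<Rightarrow> complex.
      (\<forall>n. r n \<in> L2_closed_span (range (power_fun \<Lambda>)))
    \<and> biorthogonal r (power_fun \<Lambda>)
    \<and> (\<forall>s. (\<forall>n. s n \<in> L2_closed_span (range (power_fun \<Lambda>))) \<and> biorthogonal s (power_fun \<Lambda>)
          \<longrightarrow> (\<forall>n. AE t in leb01. s n t = r n t))
    \<and> (\<forall>\<epsilon>>0. \<exists>m>0. \<forall>n. L2_norm01 (r n) \<le> m * (1 + \<epsilon>) powr \<Lambda> n)"
proof -
  note mono = assms(1) and pos = assms(2) and summ = assms(3)
  define d where "d = (INF n. \<Lambda> (Suc n) - \<Lambda> n)"
  have "bdd_below (range (\<lambda>n. \<Lambda> (Suc n) - \<Lambda> n))"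
    using mono by (intro bdd_belowI[of _ 0]) (auto simp: strict_mono_def less_imp_le)
  then have gap: "d \<le> \<Lambda> (Suc n) - \<Lambda> n" for n
    unfolding d_def by (rule cINF_lower) simp
  have d: "d > 0" using assms(4) by (simp add: d_def)
  note bound = L2_norm_dual_fun_bound[OF mono pos summ gap d]
  have "\<exists>r\<in>L2_closed_span (range (power_fun \<Lambda>)).
    (\<forall>m. L2_inner (power_fun \<Lambda> m) r = (if m = n then 1 else 0)) \<and>
    (\<forall>b. (\<forall>N\<ge>n. L2_norm01 (dual_fun \<Lambda> N n) \<le> b) \<longrightarrow> L2_norm01 r \<le> b)" for n
  proof -
    \<comment> \<open>Any fixed rate will do: for given \<open>n\<close> this is just a bound
      uniform in \<open>N\<close>.\<close>
    obtain m where "\<forall>n N. n \<le> N \<longrightarrow> L2_norm01 (dual_fun \<Lambda> N n) \<le> m * (1 + 1) powr \<Lambda> n"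
      using bound[of 1] by auto
    then show ?thesis by (intro dual_limit[OF mono pos]) blast
  qed
  then obtain r where span: "\<And>n. r n \<in> L2_closed_span (range (power_fun \<Lambda>))"
    and inner: "\<And>n m. L2_inner (power_fun \<Lambda> m) (r n) = (if m = n then 1 else 0)"
    and norm: "\<And>n b. (\<forall>N\<ge>n. L2_norm01 (dual_fun \<Lambda> N n) \<le> b) \<Longrightarrow> L2_norm01 (r n) \<le> b"
    by metis
  have bi: "biorthogonal r (power_fun \<Lambda>)"
    by (simp add: biorthogonal_def inner)
  have eL: "range (power_fun \<Lambda>) \<subseteq> L2_01"
    using pos power_fun_L2 by blast
  have unique: "AE t in leb01. s n t = r n t"
    if s: "\<And>n. s n \<in> L2_closed_span (range (power_fun \<Lambda>))" "biorthogonal s (power_fun \<Lambda>)" for s n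
  proof -
    have L: "s n \<in> L2_01" "r n \<in> L2_01"
      using s(1)[of n] span[of n] by (simp_all add: L2_closed_span_def)
    \<comment> \<open>\<open>h\<close> is orthogonal to all powers, hence to \<open>s n\<close> and
      \<open>r n\<close> in their closed span, hence to itself.\<close>
    define h where "h t = s n t - r n t" for t
    have h: "h \<in> L2_01" unfolding h_def[abs_def] using L by (rule L2_01_diff)
    have orth: "L2_inner g h = 0" if "g \<in> range (power_fun \<Lambda>)" for g
    proof -
      have "g \<in> L2_01" using that eL by blast
      then have "L2_inner g h = L2_inner g (s n) - L2_inner g (r n)"
        unfolding h_def[abs_def] by (rule L2_inner_diff_right[OF L])
      also have "\<dots> = 0" using that s(2) bi by (auto simp: biorthogonal_def)
      finally show ?thesis .
    qed
    have "L2_inner h h = L2_inner (s n) h - L2_inner (r n) h"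
      by (subst (1) h_def[abs_def]) (rule L2_inner_diff_left[OF L h])
    also have "\<dots> = 0"
      using closed_span_orthogonal[OF eL s(1) h orth] closed_span_orthogonal[OF eL span h orth] by simp
    finally have "L2_norm01 h = 0" by (simp add: L2_inner_self)
    with h have "AE t in leb01. h t = 0" by (rule L2_norm01_eq_0_imp_AE)
    then show ?thesis by (simp add: h_def)
  qed
  \<comment> \<open>The constant of the dual functions carries over, with \<open>b\<close> taken as
    \<open>m * (1 + \<epsilon>) powr \<Lambda> n\<close>.\<close>
  have "\<exists>m>0. \<forall>n. L2_norm01 (r n) \<le> m * (1 + \<epsilon>) powr \<Lambda> n" if "\<epsilon> > 0" for \<epsilon>
    using bound[OF that] norm by meson
  then show ?thesis using span bi unique by blast
qed

end
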